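(* Let $p$ be a prime, let $d\geq 2$ be a power of $p$, and let $\mathbb{K}$ be a field extending $\mathbb{Q}$, equipped with a valuation $\nu$ extending the $p$-adic valuation $\nu_p$ on $\mathbb{Q}$. Let ${\bf a}=(a_1,\ldots,a_{d-1})\in\mathbb{K}^{d-1}$ and $b\in\mathbb{K}$, and suppose that the barycenter $\bar{\bf a}=\frac{1}{d-1}\sum_{i=1}^{d-1}a_i$ is $\nu$-integral. Then the degree $d$ polynomial $F_{{\bf a},b}$ is postcritically bounded if and only if ${\bf a}$ and $b$ are $\nu$-integral.
   Context: For ${\bf a}=(a_1,\ldots,a_{d-1})\in\mathbb{K}^{d-1}$ and $b\in\mathbb{K}$, let $\sigma_k$ be the $k$-th elementary symmetric function of $a_1,\ldots,a_{d-1}$, let $\bar{\bf a}=\frac{1}{d-1}\sum_{i=1}^{d-1}a_i$, and define $$F_{{\bf a},b}(z)=z^d+\sum_{k=1}^{d-1}(-1)^{d-k}\frac{d}{k}\sigma_{d-k}z^k+b-\bar{\bf a}^d-\sum_{k=1}^{d-1}(-1)^{d-k}\frac{d}{k}\sigma_{d-k}\bar{\bf a}^k .$$ This is the unique monic polynomial of degree $d$ whose critical points, listed with multiplicity, are $a_1,\ldots,a_{d-1}$ (i.e. $F_{{\bf a},b}'(z)=d\prod_i(z-a_i)$) and which satisfies $F_{{\bf a},b}(\bar{\bf a})=b$. Valuations are written additively, $\nu:\mathbb{K}\to\mathbb{R}\cup\{\infty\}$, and $\nu_p$ is normalized by $\nu_p(p)=1$. An element $\zeta\in\mathbb{K}$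 is $\nu$-integral if $\nu(\zeta)\geq 0$; a vector is $\nu$-integral if all its components are. With $F^0(z)=z$ and $F^{n+1}(z)=F(F^n(z))$, the forward orbit of $\zeta$ under $F$ is bounded if the sequence $\nu(F^n(\zeta))$, $n\geq 0$, is bounded from below. $F_{{\bf a},b}$ is postcritically bounded if the forward orbit of every critical point $a_i$ is bounded. *)

theory Defs
  imports "HOL-Computational_Algebra.Computational_Algebra" "HOL-Library.Extended_Real"
begin

definition valuation :: "('k::field \<Rightarrow> ereal) \<Rightarrow> bool" where
  "valuation \<nu> \<longleftrightarrow>
     (\<forall>x. \<nu> x \<noteq> -\<infinity>) \<and>
     (\<forall>x. \<nu> x = \<infinity> \<longleftrightarrow> x = 0) \<and>
     (\<forall>x y. \<nu> (x * y) = \<nu> x + \<nu> y) \<and>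
     (\<forall>x y. \<nu> (x + y) \<ge> min (\<nu> x) (\<nu> y))"

definition padic_val :: "nat \<Rightarrow> rat \<Rightarrow> ereal" where
  "padic_val p q =
     (if q = 0 then \<infinity>
      else ereal (real (multiplicity (int p) (fst (quotient_of q))) -
                  real (multiplicity (int p) (snd (quotient_of q)))))"

definition extends_padic :: "nat \<Rightarrow> ('k::field_char_0 \<Rightarrow> ereal) \<Rightarrow> bool" where
  "extends_padic p \<nu> \<longleftrightarrow> (\<forall>q::rat. \<nu> (of_rat q) = padic_val p q)"

definition integral_at :: "('k \<Rightarrow> ereal) \<Rightarrow> 'k \<Rightarrow> bool" where
  "integral_at \<nu> x \<longleftrightarrow> \<nu> x \<ge> 0"

text \<open>A vector \<open>(a\<^sub>1, \<dots>, a\<^sub>n)\<close> is a function \<open>a\<close> on the naturals of which only the values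
  on \<open>{1..n}\<close> are ever used.\<close>

definition integral_vec_at :: "('k \<Rightarrow> ereal) \<Rightarrow> nat \<Rightarrow> (nat \<Rightarrow> 'k) \<Rightarrow> bool" where
  "integral_vec_at \<nu> n a \<longleftrightarrow> (\<forall>i\<in>{1..n}. integral_at \<nu> (a i))"

definition elem_sym :: "nat \<Rightarrow> (nat \<Rightarrow> 'k::comm_ring_1) \<Rightarrow> nat \<Rightarrow> 'k" where
  "elem_sym n a k = (\<Sum>I | I \<subseteq> {1..n} \<and> card I = k. \<Prod>i\<in>I. a i)"

definition barycenter :: "nat \<Rightarrow> (nat \<Rightarrow> 'k::field) \<Rightarrow> 'k" where
  "barycenter n a = (1 / of_nat n) * (\<Sum>i=1..n. a i)"

definition crit_coeff :: "nat \<Rightarrow> (nat \<Rightarrow> 'k::field) \<Rightarrow> nat \<Rightarrow> 'k" where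
  "crit_coeff d a k = (-1) ^ (d - k) * (of_nat d / of_nat k) * elem_sym (d - 1) a (d - k)"

definition crit_poly :: "nat \<Rightarrow> (nat \<Rightarrow> 'k::field) \<Rightarrow> 'k \<Rightarrow> 'k poly" where
  "crit_poly d a b =
     monom 1 d + (\<Sum>k=1..d-1. monom (crit_coeff d a k) k)
     + [: b - barycenter (d - 1) a ^ d
          - (\<Sum>k=1..d-1. crit_coeff d a k * barycenter (d - 1) a ^ k) :]"

text \<open>The lower bound has to be a real number: every set of extended reals is bounded below
  by \<open>-\<infinity>\<close>, so \<open>bdd_below\<close> would hold trivially.\<close>

definition bounded_orbit :: "('k \<Rightarrow> ereal) \<Rightarrow> ('k \<Rightarrow> 'k) \<Rightarrow> 'k \<Rightarrow> bool" where
  "bounded_orbit \<nu> f x \<longleftrightarrow> (\<exists>M::real. \<forall>n. ereal M \<le> \<nu> ((f ^^ n) x))"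

text \<open>The critical points of \<open>crit_poly d a b\<close> are \<open>a\<^sub>1, \<dots>, a\<^sub>d\<^sub>-\<^sub>1\<close>;
  see \<open>pderiv_crit_poly\<close> below.\<close>

definition postcritically_bounded ::
    "('k::field \<Rightarrow> ereal) \<Rightarrow> nat \<Rightarrow> (nat \<Rightarrow> 'k) \<Rightarrow> 'k \<Rightarrow> bool" where
  "postcritically_bounded \<nu> d a b \<longleftrightarrow>
     (\<forall>i\<in>{1..d-1}. bounded_orbit \<nu> (poly (crit_poly d a b)) (a i))"

lemma poly_crit_poly:
  "poly (crit_poly d a b) z =
     z ^ d + (\<Sum>k=1..d-1. (-1) ^ (d - k) * (of_nat d / of_nat k) * elem_sym (d - 1) a (d - k) * z ^ k)
     + b - barycenter (d - 1) a ^ d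
     - (\<Sum>k=1..d-1. (-1) ^ (d - k) * (of_nat d / of_nat k) * elem_sym (d - 1) a (d - k)
                      * barycenter (d - 1) a ^ k)"
  by (simp add: crit_poly_def crit_coeff_def poly_sum poly_monom)

lemma poly_crit_poly_barycenter: "poly (crit_poly d a b) (barycenter (d - 1) a) = b"
  by (simp add: poly_crit_poly)

lemma coeff_crit_poly_ge: "d \<ge> 1 \<Longrightarrow> n \<ge> d \<Longrightarrow> coeff (crit_poly d a b) n = (if n = d then 1 else 0)"
  by (auto simp: crit_poly_def coeff_sum coeff_pCons split: nat.split intro!: sum.neutral)

lemma degree_crit_poly: "d \<ge> 1 \<Longrightarrow> degree (crit_poly d a b) = d"
  by (intro antisym degree_le le_degree) (auto simp: coeff_crit_poly_ge)

lemma lead_coeff_crit_poly: "d \<ge> 1 \<Longrightarrow> lead_coeff (crit_poly d a b) = 1"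
  by (simp add: degree_crit_poly coeff_crit_poly_ge)

lemma prod_linear_elem_sym:
  fixes a :: "nat \<Rightarrow> 'k::comm_ring_1"
  shows "(\<Prod>i=1..n. [:- a i, 1:]) = (\<Sum>j\<le>n. monom ((-1) ^ j * elem_sym n a j) (n - j))"
proof -
  have "(\<Prod>i=1..n. [:- a i, 1:]) = (\<Prod>i=1..n. [:- a i:] + monom 1 1)"
    by (simp add: monom_altdef)
  also have "\<dots> = (\<Sum>I\<in>Pow {1..n}. (\<Prod>i\<in>I. [:- a i:]) * (\<Prod>i\<in>{1..n} - I. monom 1 1))"
    by (rule prod_add) simp
  also have "\<dots> = (\<Sum>I\<in>Pow {1..n}. monom ((-1) ^ card I * (\<Prod>i\<in>I. a i)) (n - card I))"
  proof (rule sum.cong)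
    fix I assume "I \<in> Pow {1..n}"
    then have I: "I \<subseteq> {1..n}" and fin: "finite I" by (auto intro: finite_subset)
    have "(\<Prod>i\<in>I. [:- a i:]) = [:(-1) ^ card I * (\<Prod>i\<in>I. a i):]"
      using fin by (induction I rule: finite_induct) (simp_all add: algebra_simps)
    moreover have "card ({1..n} - I) = n - card I"
      using I fin by (simp add: card_Diff_subset)
    ultimately show "(\<Prod>i\<in>I. [:- a i:]) * (\<Prod>i\<in>{1..n} - I. monom 1 1) =
        monom ((-1) ^ card I * (\<Prod>i\<in>I. a i)) (n - card I)"
      by (simp add: monom_power smult_monom)
  qed simp
  also have "\<dots> = (\<Sum>j\<le>n. \<Sum>I\<in>{I\<in>Pow {1..n}. card I = j}.
                    monom ((-1) ^ card I * (\<Prod>i\<in>I. a i)) (n - card I))"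
  proof (rule sum.group[symmetric])
    show "card ` Pow {1..n} \<subseteq> {..n}"
      using card_mono[of "{1..n}"] by fastforce
  qed auto
  also have "\<dots> = (\<Sum>j\<le>n. monom ((-1) ^ j * elem_sym n a j) (n - j))"
    by (intro sum.cong) (auto simp: elem_sym_def sum_distrib_left Pow_def monom_sum)
  finally show ?thesis .
qed

lemma pderiv_crit_poly:
  fixes a :: "nat \<Rightarrow> 'k::field_char_0"
  assumes "d \<ge> 1"
  shows "pderiv (crit_poly d a b) = smult (of_nat d) (\<Prod>i=1..d-1. [:- a i, 1:])"
proof -
  have smult_sum_right: "smult c (\<Sum>j\<in>A. f j) = (\<Sum>j\<in>A. smult c (f j))"
    for c and A and f :: "nat \<Rightarrow> 'k poly"
    by (induction A rule: infinite_finite_induct) (simp_all add: smult_add_right)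
  have "pderiv (crit_poly d a b) =
      monom (of_nat d) (d - 1) + (\<Sum>k=1..d-1. monom (of_nat k * crit_coeff d a k) (k - 1))"
    by (simp add: crit_poly_def pderiv_add higher_pderiv_sum[of 1, simplified] pderiv_monom pderiv_pCons)
  also have "(\<Sum>k=1..d-1. monom (of_nat k * crit_coeff d a k) (k - 1)) =
      (\<Sum>j=1..d-1. monom (of_nat d * ((-1) ^ j * elem_sym (d - 1) a j)) (d - 1 - j))"
    by (rule sum.reindex_bij_witness[of _ "\<lambda>j. d - j" "\<lambda>k. d - k"])
       (auto simp: crit_coeff_def field_simps)
  also have "monom (of_nat d) (d - 1) + \<dots> =
      (\<Sum>j\<le>d-1. monom (of_nat d * ((-1) ^ j * elem_sym (d - 1) a j)) (d - 1 - j))"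
  proof -
    have "{I. I \<subseteq> {Suc 0..d - 1} \<and> card I = 0} = {{}}"
      by (auto dest: finite_subset)
    then have "elem_sym (d - 1) a 0 = 1"
      by (simp add: elem_sym_def)
    moreover have "{..d-1} = insert 0 {1..d-1}" by auto
    ultimately show ?thesis by simp
  qed
  also have "\<dots> = smult (of_nat d) (\<Prod>i=1..d-1. [:- a i, 1:])"
    unfolding prod_linear_elem_sym by (simp add: smult_sum_right smult_monom)
  finally show ?thesis .
qed

end

theory Submission
  imports Defs
begin

text \<open>
  Write \<open>F(z) = z\<^sup>d + H(z) + c\<close> with \<open>c = F(0)\<close>. As \<open>d\<close> is a power of \<open>p\<close>, the factor \<open>d/k\<close>
  in the \<open>k\<close>-th coefficient of \<open>H\<close> has valuation at least \<open>1\<close> for \<open>0 < k < d\<close>. So if \<open>t\<close> bounds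
  the valuations of the critical points and of \<open>z\<close> from below, then \<open>H(z)\<close> has valuation at
  least \<open>1 + d t\<close> (\<open>crit_tail_ge\<close>). With \<open>t = 0\<close> this says that integral data give
  a polynomial with integral coefficients, which maps integral points to integral points.

  For the converse, let \<open>r \<le> 0\<close> be the minimum of \<open>0\<close> and the valuations of the \<open>a\<^sub>i\<close>. Points
  whose valuation is smaller than \<open>r\<close> escape as soon as \<open>\<nu>(c) \<ge> d r\<close> (\<open>bounded_orbit_ge\<close>),
  because then \<open>z\<^sup>d\<close> dominates \<open>F(z)\<close>. If the critical orbits are bounded, then
  indeed \<open>\<nu>(c) \<ge> d r\<close> (\<open>const_term_ge\<close>), as otherwise \<open>c\<close> dominates \<open>F(a\<^sub>i)\<close> and this value
  escapes. Hence \<open>\<nu>(F(a\<^sub>i)) \<ge> r\<close> for all \<open>i\<close>.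

  Suppose \<open>r < 0\<close>. Then \<open>r > d r\<close>, so \<open>F(a\<^sub>i) - F(a\<^sub>j)\<close> is small compared with the \<open>d\<close>-th power of
  the largest \<open>a\<^sub>i\<close>, and so are the values of \<open>H\<close>; hence \<open>a\<^sub>i\<^sup>d - a\<^sub>j\<^sup>d\<close> is small as well. In other
  words, once the points are divided by one of valuation \<open>r\<close>, their \<open>d\<close>-th powers agree in the
  residue field, which has characteristic \<open>p\<close>. There the map \<open>x \<mapsto> x\<^sup>d\<close> is injective, so
  \<open>\<nu>(a\<^sub>i - a\<^sub>j) > r\<close> (\<open>diff_gt\<close>). As their number \<open>d - 1\<close> is a unit, the critical points then
  cluster around their barycenter, and this being integral, all \<open>\<nu>(a\<^sub>j)\<close> exceed \<open>r\<close>
  (\<open>gt_if_cluster\<close>). This contradicts the choice of \<open>r\<close>. So \<open>r = 0\<close>, that is,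
  all \<open>a\<^sub>i\<close> and \<open>c\<close> are integral, and then so is \<open>b\<close>, the value of \<open>F\<close> at the barycenter.
\<close>

section \<open>Valuations\<close>

locale valued_field =
  fixes \<nu> :: "'k::field \<Rightarrow> ereal"
  assumes valuation: "valuation \<nu>"
begin

lemma val_not_MInf: "\<nu> x \<noteq> -\<infinity>"
  and val_eq_PInf_iff: "\<nu> x = \<infinity> \<longleftrightarrow> x = 0"
  and val_mult: "\<nu> (x * y) = \<nu> x + \<nu> y"
  and val_add: "min (\<nu> x) (\<nu> y) \<le> \<nu> (x + y)"
  using valuation by (auto simp: valuation_def)

lemma val_0 [simp]: "\<nu> 0 = \<infinity>"
  by (simp add: val_eq_PInf_iff)

lemma val_1 [simp]: "\<nu> 1 = 0"
proof -
  have "\<nu> 1 = \<nu> 1 + \<nu> 1" using val_mult[of 1 1] by simp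
  then show ?thesis
    using val_not_MInf[of 1] val_eq_PInf_iff[of 1] by (cases "\<nu> 1") auto
qed

lemma val_minus [simp]: "\<nu> (- x) = \<nu> x"
proof -
  have "\<nu> (-1) + \<nu> (-1) = 0" using val_mult[of "-1" "-1"] by simp
  then have "\<nu> (-1) = 0" by (cases "\<nu> (-1)") auto
  then show ?thesis using val_mult[of "-1" x] by simp
qed

lemma add_ge: "t \<le> \<nu> x \<Longrightarrow> t \<le> \<nu> y \<Longrightarrow> t \<le> \<nu> (x + y)"
  using val_add[of x y] by (meson min.boundedI order_trans)

lemma diff_ge: "t \<le> \<nu> x \<Longrightarrow> t \<le> \<nu> y \<Longrightarrow> t \<le> \<nu> (x - y)"
  using add_ge[of t x "- y"] by simp

lemma sum_ge: "(\<And>i. i \<in> A \<Longrightarrow> t \<le> \<nu> (f i)) \<Longrightarrow> t \<le> \<nu> (\<Sum>i\<in>A. f i)"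
  by (induction A rule: infinite_finite_induct) (auto intro: add_ge)

lemma add_gt: "t < \<nu> x \<Longrightarrow> t < \<nu> y \<Longrightarrow> t < \<nu> (x + y)"
  using val_add[of x y] by (meson min_less_iff_conj order_less_le_trans)

lemma diff_gt_of_gt: "t < \<nu> x \<Longrightarrow> t < \<nu> y \<Longrightarrow> t < \<nu> (x - y)"
  using add_gt[of t x "- y"] by simp

lemma sum_gt: "(\<And>i. i \<in> A \<Longrightarrow> ereal t < \<nu> (f i)) \<Longrightarrow> ereal t < \<nu> (\<Sum>i\<in>A. f i)"
  by (induction A rule: infinite_finite_induct) (auto intro: add_gt)

lemma val_add_eq:
  assumes "\<nu> x < \<nu> y"
  shows "\<nu> (x + y) = \<nu> x"
proof (rule antisym)
  show "\<nu> x \<le> \<nu> (x + y)" using assms by (intro add_ge) auto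
  show "\<nu> (x + y) \<le> \<nu> x"
    using diff_gt_of_gt[of "\<nu> x" "x + y" y] assms by (force simp: not_le)
qed

lemma mult_ge:
  assumes "ereal s \<le> \<nu> x" "ereal t \<le> \<nu> y"
  shows "ereal (s + t) \<le> \<nu> (x * y)"
  using add_mono[OF assms] by (simp add: val_mult)

lemma power_ge: "ereal t \<le> \<nu> x \<Longrightarrow> ereal (real n * t) \<le> \<nu> (x ^ n)"
  by (induction n) (auto simp: distrib_right intro!: mult_ge)

lemma val_power: "\<nu> x = ereal t \<Longrightarrow> \<nu> (x ^ n) = ereal (real n * t)"
  by (induction n) (auto simp: val_mult distrib_right)

lemma prod_ge: "(\<And>i. i \<in> A \<Longrightarrow> ereal t \<le> \<nu> (f i)) \<Longrightarrow> ereal (real (card A) * t) \<le> \<nu> (\<Prod>i\<in>A. f i)"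
  by (induction A rule: infinite_finite_induct) (auto simp: distrib_right intro!: mult_ge)

lemma elem_sym_ge:
  assumes "\<And>i. i \<in> {1..n} \<Longrightarrow> ereal t \<le> \<nu> (a i)"
  shows "ereal (real k * t) \<le> \<nu> (elem_sym n a k)"
  unfolding elem_sym_def
proof (rule sum_ge)
  fix I assume I: "I \<in> {I. I \<subseteq> {1..n} \<and> card I = k}"
  then have "ereal (real (card I) * t) \<le> \<nu> (\<Prod>i\<in>I. a i)"
    using assms by (intro prod_ge) auto
  with I show "ereal (real k * t) \<le> \<nu> (\<Prod>i\<in>I. a i)" by simp
qed

lemma of_nat_ge: "0 \<le> \<nu> (of_nat n)"
  by (induction n) (auto intro: add_ge)

end

section \<open>Degrees that are powers of the residue characteristic\<close>

locale prime_power_degree = valued_field \<nu> for \<nu> :: "'k::field_char_0 \<Rightarrow> ereal" +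
  fixes p d m :: nat
  assumes prime_p: "prime p" and d_ge: "d \<ge> 2" and d_eq: "d = p ^ m"
    and extends: "extends_padic p \<nu>"
begin

lemma multiplicity_int_int:
  assumes "n > 0"
  shows "multiplicity (int p) (int n) = multiplicity p n"
proof (rule multiplicity_eqI)
  have "p ^ multiplicity p n dvd n" by (rule multiplicity_dvd)
  then show "int p ^ multiplicity p n dvd int n" by (metis int_dvd_int_iff of_nat_power)
  have "\<not> p ^ Suc (multiplicity p n) dvd n"
    using assms prime_p by (subst power_dvd_iff_le_multiplicity) auto
  then show "\<not> int p ^ Suc (multiplicity p n) dvd int n" by (metis int_dvd_int_iff of_nat_power)
qed

lemma val_of_nat:
  assumes "n > 0"
  shows "\<nu> (of_nat n) = ereal (real (multiplicity p n))"
proof -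
  have "\<nu> (of_nat n) = padic_val p (of_int (int n))"
    using extends by (metis extends_padic_def of_int_of_nat_eq of_rat_of_nat_eq)
  then show ?thesis
    using assms unfolding padic_val_def quotient_of_int
    by (simp add: multiplicity_int_int)
qed

text \<open>No positive number smaller than the prime power \<open>d\<close> is divisible by as high a power
  of \<open>p\<close> as \<open>d\<close> itself. This gives the gain of \<open>1\<close> in all estimates below.\<close>

lemma degree_quotient_ge:
  assumes "0 < k" "k < d"
  shows "1 \<le> \<nu> (of_nat d / of_nat k)"
proof -
  have "p ^ multiplicity p k \<le> k"
    using assms by (intro dvd_imp_le multiplicity_dvd)
  then have "p ^ multiplicity p k < p ^ m" using assms d_eq by linarith
  then have less: "multiplicity p k < m"
    using prime_gt_1_nat[OF prime_p] by (simp add: power_strict_increasing_iff)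
  have "multiplicity p d = m" using prime_p d_eq by simp
  moreover have "\<nu> (of_nat d) = \<nu> (of_nat d / of_nat k) + \<nu> (of_nat k)"
    using assms by (simp flip: val_mult)
  ultimately show ?thesis
    using less assms d_ge val_of_nat[of d] val_of_nat[of k]
    by (cases "\<nu> (of_nat d / of_nat k)") (auto simp: one_ereal_def)
qed

lemma binomial_ge:
  assumes "0 < k" "k < d"
  shows "1 \<le> \<nu> (of_nat (d choose k))"
proof -
  have "k * (d choose k) = d * ((d - 1) choose (k - 1))"
    using assms binomial_absorption[of "k - 1" d] by simp
  then have "of_nat k * of_nat (d choose k) = (of_nat d * of_nat ((d - 1) choose (k - 1)) :: 'k)"
    by (metis of_nat_mult)
  then have "of_nat (d choose k) = (of_nat d / of_nat k * of_nat ((d - 1) choose (k - 1)) :: 'k)"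
    using assms by (simp add: field_simps)
  then show ?thesis
    using add_mono[OF degree_quotient_ge[OF assms] of_nat_ge[of "(d - 1) choose (k - 1)"]]
    by (simp only: val_mult) simp
qed

lemma val_degree_minus_1: "\<nu> (of_nat (d - 1)) = 0"
proof -
  have "m \<noteq> 0" using d_ge d_eq by (intro notI) simp
  then have "p dvd d" using d_eq by simp
  then have "\<not> p dvd d - 1"
    using dvd_diff_nat[of p d "d - 1"] d_ge prime_p by auto
  then show ?thesis
    using d_ge val_of_nat[of "d - 1"] by (simp add: not_dvd_imp_multiplicity_0)
qed

text \<open>The freshman's dream in the residue field, after scaling \<open>x\<close> and \<open>y\<close> to be integral.\<close>

lemma freshmans_dream:
  assumes "ereal t \<le> \<nu> x" "ereal t \<le> \<nu> y"
  shows "ereal (1 + real d * t) \<le> \<nu> ((x + y) ^ d - x ^ d - y ^ d)"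
proof -
  have split: "{..d} = insert 0 (insert d {1..d-1})" using d_ge by auto
  have "(x + y) ^ d - x ^ d - y ^ d = (\<Sum>k=1..d-1. of_nat (d choose k) * x ^ k * y ^ (d - k))"
    unfolding binomial_ring split using d_ge by (subst sum.insert, simp, simp)+ simp
  also have "ereal (1 + real d * t) \<le> \<nu> \<dots>"
  proof (rule sum_ge)
    fix k assume k: "k \<in> {1..d-1}"
    have "ereal (1 + real k * t + real (d - k) * t) \<le> \<nu> (of_nat (d choose k) * x ^ k * y ^ (d - k))"
      using k d_ge binomial_ge[of k] assms by (intro mult_ge power_ge) (auto simp: one_ereal_def)
    moreover have "1 + real k * t + real (d - k) * t = 1 + real d * t"
      using k d_ge by (auto simp: of_nat_diff algebra_simps)
    ultimately show "ereal (1 + real d * t) \<le> \<nu> (of_nat (d choose k) * x ^ k * y ^ (d - k))"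
      by (simp only:)
  qed
  finally show ?thesis .
qed

text \<open>Injectivity of \<open>x \<mapsto> x\<^sup>d\<close> on the residue field. Expanding \<open>x\<^sup>d\<close> as a power of
  \<open>(x - y) + y\<close> avoids the sign of \<open>(- y)\<^sup>d\<close>, which depends on the parity of \<open>p\<close>.\<close>

lemma diff_gt_of_power_diff_gt:
  assumes x: "ereal t \<le> \<nu> x" and y: "ereal t \<le> \<nu> y"
    and xy: "ereal (real d * t) < \<nu> (x ^ d - y ^ d)"
  shows "ereal t < \<nu> (x - y)"
proof -
  have ge: "ereal t \<le> \<nu> (x - y)" using x y by (rule diff_ge)
  have "ereal (1 + real d * t) \<le> \<nu> (x ^ d - (x - y) ^ d - y ^ d)"
    using freshmans_dream[OF ge y] by simp
  then have "ereal (real d * t) < \<nu> (x ^ d - (x - y) ^ d - y ^ d)"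
    by (rule order_less_le_trans[rotated]) simp
  from diff_gt_of_gt[OF xy this] have "ereal (real d * t) < \<nu> ((x - y) ^ d)" by simp
  then have "\<nu> (x - y) \<noteq> ereal t" using val_power[of "x - y" t d] by auto
  with ge show ?thesis by simp
qed

section \<open>Size of the polynomial\<close>

definition crit_tail :: "(nat \<Rightarrow> 'k) \<Rightarrow> 'k \<Rightarrow> 'k" where
  "crit_tail a z = (\<Sum>k=1..d-1. crit_coeff d a k * z ^ k)"

lemma poly_crit_poly_eq:
  "poly (crit_poly d a b) z = z ^ d + crit_tail a z + poly (crit_poly d a b) 0"
  using d_ge by (simp add: crit_poly_def crit_tail_def poly_sum poly_monom zero_power)

text \<open>\<open>z\<^sup>d\<close> and \<open>\<sigma>\<^bsub>d-k\<^esub> z\<^sup>k\<close> have the same weighted degree, so only the factors \<open>d/k\<close> make the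
  tail smaller.\<close>

lemma crit_tail_ge:
  assumes "\<And>i. i \<in> {1..d-1} \<Longrightarrow> ereal t \<le> \<nu> (a i)" and "ereal t \<le> \<nu> z"
  shows "ereal (1 + real d * t) \<le> \<nu> (crit_tail a z)"
  unfolding crit_tail_def
proof (rule sum_ge)
  fix k assume k: "k \<in> {1..d-1}"
  have "ereal (real (d - k) * 0) \<le> \<nu> ((- 1) ^ (d - k))"
    by (rule power_ge) simp
  then have "ereal (0 + 1 + real (d - k) * t + real k * t) \<le> \<nu> (crit_coeff d a k * z ^ k)"
    unfolding crit_coeff_def using k d_ge assms degree_quotient_ge[of k]
    by (intro mult_ge power_ge elem_sym_ge) (auto simp: one_ereal_def)
  moreover have "0 + 1 + real (d - k) * t + real k * t = 1 + real d * t"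
    using k d_ge by (auto simp: of_nat_diff algebra_simps)
  ultimately show "ereal (1 + real d * t) \<le> \<nu> (crit_coeff d a k * z ^ k)" by (simp only:)
qed

lemma integral_poly_crit_poly_iff:
  assumes "\<And>i. i \<in> {1..d-1} \<Longrightarrow> 0 \<le> \<nu> (a i)" and "0 \<le> \<nu> z"
  shows "0 \<le> \<nu> (poly (crit_poly d a b) z) \<longleftrightarrow> 0 \<le> \<nu> (poly (crit_poly d a b) 0)"
proof -
  let ?F = "poly (crit_poly d a b)"
  have "ereal 1 \<le> \<nu> (crit_tail a z)"
    using crit_tail_ge[of 0 a z] assms by (simp add: zero_ereal_def)
  then have "0 \<le> \<nu> (crit_tail a z)"
    by (rule order_trans[rotated]) simp
  moreover have "0 \<le> \<nu> (z ^ d)"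
    using power_ge[of 0 z d] assms by (simp add: zero_ereal_def)
  ultimately have "0 \<le> \<nu> (z ^ d + crit_tail a z)" by (intro add_ge)
  moreover have "?F z = z ^ d + crit_tail a z + ?F 0" by (rule poly_crit_poly_eq)
  ultimately show ?thesis
    using add_ge[of 0 "z ^ d + crit_tail a z" "?F 0"] diff_ge[of 0 "?F z" "z ^ d + crit_tail a z"]
    by auto
qed

section \<open>Escape to infinity\<close>

text \<open>For \<open>s < t\<close> the tail and the constant term have valuation greater than \<open>d s\<close>, so \<open>z\<^sup>d\<close>
  dominates.\<close>

lemma val_poly_crit_poly_far:
  assumes a: "\<And>i. i \<in> {1..d-1} \<Longrightarrow> ereal t \<le> \<nu> (a i)"
    and c: "ereal (real d * t) \<le> \<nu> (poly (crit_poly d a b) 0)"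
    and z: "\<nu> z = ereal s" "s < t"
  shows "\<nu> (poly (crit_poly d a b) z) = ereal (real d * s)"
proof -
  have "ereal s \<le> \<nu> (a i)" if "i \<in> {1..d-1}" for i
    using a[OF that] z(2) by (meson ereal_less_eq(3) less_imp_le order_trans)
  then have "ereal (1 + real d * s) \<le> \<nu> (crit_tail a z)"
    using z(1) by (intro crit_tail_ge) auto
  then have "ereal (real d * s) < \<nu> (crit_tail a z)"
    by (rule order_less_le_trans[rotated]) simp
  moreover have "ereal (real d * s) < \<nu> (poly (crit_poly d a b) 0)"
    using c by (rule order_less_le_trans[rotated]) (use z(2) d_ge in simp)
  ultimately have "\<nu> (z ^ d) < \<nu> (crit_tail a z + poly (crit_poly d a b) 0)"
    by (simp add: val_power[OF z(1)] add_gt)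
  from val_add_eq[OF this] show ?thesis
    by (subst poly_crit_poly_eq) (simp add: val_power[OF z(1)] add.assoc)
qed

text \<open>Below the level \<open>t \<le> 0\<close> every iteration multiplies the valuation by \<open>d\<close>.\<close>

lemma bounded_orbit_ge:
  assumes a: "\<And>i. i \<in> {1..d-1} \<Longrightarrow> ereal t \<le> \<nu> (a i)"
    and c: "ereal (real d * t) \<le> \<nu> (poly (crit_poly d a b) 0)"
    and t: "t \<le> 0"
    and z: "bounded_orbit \<nu> (poly (crit_poly d a b)) z"
  shows "ereal t \<le> \<nu> z"
proof (rule ccontr)
  let ?F = "poly (crit_poly d a b)"
  assume "\<not> ereal t \<le> \<nu> z"
  then obtain s where s: "\<nu> z = ereal s" "s < t"
    using val_not_MInf[of z] by (cases "\<nu> z") auto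
  have le: "real d ^ n * s \<le> s" for n
    using s t d_ge mult_right_mono_neg[of 1 "real d ^ n" s] by simp
  have orbit: "\<nu> ((?F ^^ n) z) = ereal (real d ^ n * s)" for n
  proof (induction n)
    case (Suc n)
    then show ?case
      using val_poly_crit_poly_far[OF a c Suc] le[of n] s(2) by (simp add: mult.assoc)
  qed (simp add: s)
  obtain M where M: "\<And>n. ereal M \<le> \<nu> ((?F ^^ n) z)"
    using z by (auto simp: bounded_orbit_def)
  obtain n where "M / s < real d ^ n"
    using real_arch_pow[of "real d" "M / s"] d_ge by auto
  then have "real d ^ n * s < M" using s t by (simp add: neg_divide_less_eq)
  moreover have "M \<le> real d ^ n * s" using M[of n] orbit[of n] by simp
  ultimately show False by simp
qed

lemma bounded_orbit_step: "bounded_orbit \<nu> f x \<Longrightarrow> bounded_orbit \<nu> f (f x)"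
  unfolding bounded_orbit_def by (metis funpow_Suc_right comp_apply)

text \<open>If the constant term had valuation \<open>s < d r\<close>, it would dominate every critical value.
  The escape bound at \<open>s / d < r\<close>, the largest one that \<open>c\<close> permits, excludes valuation \<open>s\<close>
  for points with bounded orbit, since \<open>s < s / d\<close>.\<close>

lemma const_term_ge:
  assumes a: "\<And>i. i \<in> {1..d-1} \<Longrightarrow> ereal r \<le> \<nu> (a i)" and r: "r \<le> 0"
    and pcb: "postcritically_bounded \<nu> d a b"
  shows "ereal (real d * r) \<le> \<nu> (poly (crit_poly d a b) 0)"
proof (rule ccontr)
  let ?F = "poly (crit_poly d a b)"
  assume "\<not> ereal (real d * r) \<le> \<nu> (?F 0)"
  then obtain s where s: "\<nu> (?F 0) = ereal s" "s < real d * r"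
    using val_not_MInf[of "?F 0"] by (cases "\<nu> (?F 0)") auto
  have "real d * r \<le> 0" using r by (simp add: mult_nonneg_nonpos)
  then have s0: "s < 0" using s(2) by linarith
  have sd: "s / real d < r" using s(2) d_ge by (simp add: pos_divide_less_eq mult.commute)
  have 1: "1 \<in> {1..d-1}" using d_ge by auto
  have "ereal s < \<nu> (a 1 ^ d)"
    using power_ge[OF a[OF 1], of d] s(2) by (meson ereal_less_le less_ereal.simps(1) order_less_le_trans)
  moreover have "ereal s < \<nu> (crit_tail a (a 1))"
    using crit_tail_ge[OF a a[OF 1]] by (rule order_less_le_trans[rotated]) (use s(2) in auto)
  ultimately have "\<nu> (?F 0) < \<nu> (a 1 ^ d + crit_tail a (a 1))"
    by (simp add: s add_gt)
  from val_add_eq[OF this] have "\<nu> (?F (a 1)) = ereal s"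
    by (subst poly_crit_poly_eq) (simp add: s add.commute)
  moreover have "ereal (s / real d) \<le> \<nu> (?F (a 1))"
  proof (rule bounded_orbit_ge)
    show "ereal (s / real d) \<le> \<nu> (a i)" if "i \<in> {1..d-1}" for i
      using a[OF that] sd by (meson ereal_less_eq(3) less_imp_le order_trans)
    show "bounded_orbit \<nu> ?F (?F (a 1))"
      using pcb 1 by (intro bounded_orbit_step) (auto simp: postcritically_bounded_def)
  qed (use s s0 d_ge in \<open>auto simp: divide_nonpos_nonneg\<close>)
  moreover have "s < s / real d" using s0 d_ge by (simp add: pos_less_divide_eq)
  ultimately show False by simp
qed

section \<open>Clustering of the critical points\<close>

lemma diff_gt:
  assumes a: "\<And>i. i \<in> {1..d-1} \<Longrightarrow> ereal r \<le> \<nu> (a i)" and r: "r < 0"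
    and pcb: "postcritically_bounded \<nu> d a b"
    and ij: "i \<in> {1..d-1}" "j \<in> {1..d-1}"
  shows "ereal r < \<nu> (a i - a j)"
proof (rule diff_gt_of_power_diff_gt)
  let ?F = "poly (crit_poly d a b)"
  have F: "ereal (real d * r) < \<nu> (?F (a k))" if k: "k \<in> {1..d-1}" for k
  proof -
    have "ereal r \<le> \<nu> (?F (a k))"
    proof (rule bounded_orbit_ge[OF a])
      show "ereal (real d * r) \<le> \<nu> (?F 0)" using a r pcb by (intro const_term_ge) auto
      show "bounded_orbit \<nu> ?F (?F (a k))"
        using pcb k by (intro bounded_orbit_step) (auto simp: postcritically_bounded_def)
    qed (use r in auto)
    then show ?thesis
      by (rule order_less_le_trans[rotated]) (use r d_ge in simp)
  qed
  have T: "ereal (real d * r) < \<nu> (crit_tail a (a k))" if "k \<in> {1..d-1}" for k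
    using crit_tail_ge[OF a a[OF that]] by (rule order_less_le_trans[rotated]) auto
  have "a i ^ d - a j ^ d = (?F (a i) - ?F (a j)) - (crit_tail a (a i) - crit_tail a (a j))"
    unfolding poly_crit_poly_eq[of a b "a i"] poly_crit_poly_eq[of a b "a j"] by simp
  also have "ereal (real d * r) < \<nu> \<dots>" using ij by (intro diff_gt_of_gt F T)
  finally show "ereal (real d * r) < \<nu> (a i ^ d - a j ^ d)" .
qed (use a ij in auto)

text \<open>Modulo elements of valuation greater than \<open>r\<close>, the sum of the \<open>a\<^sub>i\<close> is \<open>(d - 1) a\<^sub>j\<close>, but it is
  also \<open>d - 1\<close> times the barycenter, which vanishes; and \<open>d - 1\<close> is a unit.\<close>

lemma gt_if_cluster:
  assumes diff: "\<And>i. i \<in> {1..d-1} \<Longrightarrow> ereal r < \<nu> (a i - a j)" and r: "r < 0"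
    and bary: "0 \<le> \<nu> (barycenter (d - 1) a)"
  shows "ereal r < \<nu> (a j)"
proof -
  have unit: "\<nu> (of_nat (d - 1) * x) = \<nu> x" for x
    by (simp only: val_mult val_degree_minus_1 add_0)
  have "of_nat (d - 1) * a j = of_nat (d - 1) * barycenter (d - 1) a - (\<Sum>i=1..d-1. a i - a j)"
    using d_ge by (simp add: barycenter_def sum_subtractf)
  moreover have "ereal r < \<nu> (of_nat (d - 1) * barycenter (d - 1) a)"
    using order_less_le_trans[OF _ bary, of "ereal r"] r by (simp only: unit) simp
  moreover have "ereal r < \<nu> (\<Sum>i=1..d-1. a i - a j)"
    using diff by (rule sum_gt)
  ultimately have "ereal r < \<nu> (of_nat (d - 1) * a j)"
    by (simp only: diff_gt_of_gt)
  then show ?thesis by (simp only: unit)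
qed

lemma integral_critical_points:
  assumes pcb: "postcritically_bounded \<nu> d a b"
    and bary: "0 \<le> \<nu> (barycenter (d - 1) a)"
    and i: "i \<in> {1..d-1}"
  shows "0 \<le> \<nu> (a i)"
proof (rule ccontr)
  define R where "R = Min ((\<lambda>i. \<nu> (a i)) ` {1..d-1})"
  assume "\<not> 0 \<le> \<nu> (a i)"
  have R_le: "R \<le> \<nu> (a i)" if "i \<in> {1..d-1}" for i
    unfolding R_def using that by (intro Min_le) auto
  have "R \<in> (\<lambda>i. \<nu> (a i)) ` {1..d-1}"
    unfolding R_def using i by (intro Min_in) auto
  then obtain j where j: "j \<in> {1..d-1}" "R = \<nu> (a j)" by auto
  have "R < 0" using R_le[OF i] \<open>\<not> 0 \<le> \<nu> (a i)\<close> by auto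
  then obtain r where R: "R = ereal r"
    using val_not_MInf[of "a j"] j(2) by (cases "\<nu> (a j)") auto
  have ge: "ereal r \<le> \<nu> (a i)" if "i \<in> {1..d-1}" for i
    using R_le[OF that] unfolding R .
  have r: "r < 0" using \<open>R < 0\<close> unfolding R by simp
  have "ereal r < \<nu> (a j)"
    using diff_gt[OF ge r pcb _ j(1)] r bary by (rule gt_if_cluster)
  then show False using j(2) unfolding R by simp
qed

lemma postcritically_bounded_iff:
  assumes bary: "0 \<le> \<nu> (barycenter (d - 1) a)"
  shows "postcritically_bounded \<nu> d a b \<longleftrightarrow> (\<forall>i\<in>{1..d-1}. 0 \<le> \<nu> (a i)) \<and> 0 \<le> \<nu> b"
    (is "?pcb \<longleftrightarrow> ?a \<and> ?b")
proof -
  let ?F = "poly (crit_poly d a b)"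
  have F: "0 \<le> \<nu> (?F z) \<longleftrightarrow> 0 \<le> \<nu> (?F 0)" if ?a "0 \<le> \<nu> z" for z
    using that by (intro integral_poly_crit_poly_iff) blast+
  have b_iff: "?b \<longleftrightarrow> 0 \<le> \<nu> (?F 0)" if ?a
    using F[OF that bary] unfolding poly_crit_poly_barycenter .
  show ?thesis
  proof (intro iffI conjI)
    assume pcb: ?pcb
    show ?a using integral_critical_points[OF pcb bary] by blast
    moreover have "ereal (real d * 0) \<le> \<nu> (?F 0)"
      using \<open>?a\<close> pcb by (intro const_term_ge) (auto simp flip: zero_ereal_def)
    ultimately show ?b using b_iff by (simp flip: zero_ereal_def)
  next
    assume int: "?a \<and> ?b"
    then have step: "0 \<le> \<nu> (?F z)" if "0 \<le> \<nu> z" for z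
      using F[OF _ that] b_iff by blast
    have "0 \<le> \<nu> ((?F ^^ n) (a i))" if "i \<in> {1..d-1}" for n i
      by (induction n) (use int that step in auto)
    then show ?pcb
      unfolding postcritically_bounded_def bounded_orbit_def zero_ereal_def by blast
  qed
qed

end

section \<open>The criterion\<close>

theorem theorem1:
  fixes p d :: nat and \<nu> :: "'k::field_char_0 \<Rightarrow> ereal"
    and a :: "nat \<Rightarrow> 'k" and b :: 'k
  assumes "prime p"
    and "d \<ge> 2" and "\<exists>m. d = p ^ m"
    and "valuation \<nu>" and "extends_padic p \<nu>"
    and "integral_at \<nu> (barycenter (d - 1) a)"
  shows "postcritically_bounded \<nu> d a b \<longleftrightarrow>
         integral_vec_at \<nu> (d - 1) a \<and> integral_at \<nu> b"
proof -
  obtain m where "d = p ^ m" using assms by blast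
  then interpret prime_power_degree \<nu> p d m
    using assms by unfold_locales
  show ?thesis
    using postcritically_bounded_iff[of a b] assms
    by (simp add: integral_vec_at_def integral_at_def)
qed

end
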